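(* Let $f:\mathcal{M}\to\mathbb{R}$ be a function on a Riemannian manifold $\mathcal{M}$ that is retraction-convex with respect to a retraction $R$, and suppose that $f$ admits an inexact first-order $(\delta,L)$-oracle of degree $q\in[0,2)$, with oracle vectors $g_{\delta,L,q}(x)\in T_x\mathcal{M}$. Then for any $x\in\mathcal{M}$ and any Riemannian subgradient $g(x)\in\partial f(x)$, the following hold. (1) If $q\in[0,1)$, then $$\|g(x)-g_{\delta,L,q}(x)\|\le (2-q)\left(\frac{L}{2(1-q)}\right)^{\frac{1-q}{2-q}}\delta^{\frac{1}{2-q}}.$$ (2) If $q=1$, then $\|g(x)-g_{\delta,L,q}(x)\|\le\delta$. (3) If $q\in(1,2)$, then $f$ is differentiable, and $g_{\delta,L,q}(x)=\mathrm{grad}\, f(x)$.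
   Context: $\mathcal{M}$ is a finite-dimensional Riemannian manifold with metric $\langle\cdot,\cdot\rangle$ and induced norms $\|\cdot\|$ on tangent spaces; $\mathrm{grad}\, f$ is the Riemannian gradient. Retraction: a smooth map $R:T\mathcal{M}\to\mathcal{M}$ whose restrictions $R_x:T_x\mathcal{M}\to\mathcal{M}$ satisfy $R_x(0_x)=x$ and $DR_x(0_x)=\mathrm{id}_{T_x\mathcal{M}}$ for all $x$. Subdifferential: for a locally Lipschitz function $G$ on a finite-dimensional inner product space $X$, $\partial G(x)$ is the Clarke generalized subdifferential, $\partial G(x)=\{\xi:\langle\xi,v\rangle\le G^\circ(x;v)\ \forall v\in X\}$ with $G^\circ(x;v)=\limsup_{y\to x,\,t\downarrow0}\frac{G(y+tv)-G(y)}{t}$. For a locally Lipschitz $f:\mathcal{M}\to\mathbb{R}$, the Riemannian subdifferential is $\partial f(x):=\partial(f\circ R_x)(0_x)\subset T_x\mathcal{M}$; its elements are Riemannian subgradients. Functions whose subdifferential is used are understood to be locally Lipschitz. Retraction-convex: $f$ is retraction-convex with respect to $R$ if for any $x\in\mathcal{M}$, any $\xi,\eta\in T_x\mathcal{M}$ and any $\zeta\in\partial(f\circ R_x)(\xi)$, $f(R_x(\eta))\ge f(R_x(\xi))+\langle\zeta,\eta-\xi\rangle$. Inexact oracle: for $\delta\ge0$, $L\ge0$, $q\in[0,2)$, $f$ admits (is equipped with) an inexact first-order $(\delta,L)$-oracle of degree $q$ if for any $x\in\mathcal{M}$ there is $g_{\delta,L,q}(x)\in T_x\mathcal{M}$ such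 that $$f(R_x(\eta))\le f(x)+\langle g_{\delta,L,q}(x),\eta\rangle+\frac L2\|\eta\|^2+\delta\|\eta\|^q\quad\forall\,\eta\in T_x\mathcal{M}.$$ *)

theory Defs
  imports "HOL-Analysis.Analysis"
begin

section \<open>Smooth maps between Euclidean spaces\<close>

text \<open>Used on open sets only.\<close>

fun Ck_on :: "nat \<Rightarrow> 'a::real_normed_vector set \<Rightarrow> ('a \<Rightarrow> 'b::real_normed_vector) \<Rightarrow> bool" where
  "Ck_on 0 S f \<longleftrightarrow> continuous_on S f"
| "Ck_on (Suc k) S f \<longleftrightarrow>
     (\<forall>x\<in>S. f differentiable (at x)) \<and>
     (\<forall>v. Ck_on k S (\<lambda>x. frechet_derivative f (at x) v))"

definition smooth_on :: "'a::real_normed_vector set \<Rightarrow> ('a \<Rightarrow> 'b::real_normed_vector) \<Rightarrow> bool" where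
  "smooth_on S f \<longleftrightarrow> (\<forall>k. Ck_on k S f)"


section \<open>Smooth manifolds\<close>

text \<open>
  A manifold is given by an atlas on a set of points; its topology is the one induced by the
  atlas.  A chart is a pair of a domain and a coordinate map with values in the model space;
  the coordinate map is irrelevant outside the domain.
\<close>

type_synonym ('m, 'e) chart = "'m set \<times> ('m \<Rightarrow> 'e)"
type_synonym ('m, 'e) atlas = "('m, 'e) chart set"

definition points :: "('m, 'e) atlas \<Rightarrow> 'm set" where
  "points A = \<Union> (fst ` A)"

abbreviation chart_inv :: "('m, 'e) chart \<Rightarrow> 'e \<Rightarrow> 'm" where
  "chart_inv c \<equiv> inv_into (fst c) (snd c)"

definition smooth_atlas :: "('m, 'e::euclidean_space) atlas \<Rightarrow> bool" where
  "smooth_atlas A \<longleftrightarrow>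
     (\<forall>c\<in>A. inj_on (snd c) (fst c) \<and> open (snd c ` fst c)) \<and>
     (\<forall>c\<in>A. \<forall>d\<in>A. open (snd c ` (fst c \<inter> fst d)) \<and>
        smooth_on (snd c ` (fst c \<inter> fst d)) (snd d \<circ> chart_inv c))"

definition atlas_topology :: "('m, 'e::topological_space) atlas \<Rightarrow> 'm topology" where
  "atlas_topology A =
     topology (\<lambda>W. W \<subseteq> points A \<and> (\<forall>c\<in>A. open (snd c ` (W \<inter> fst c))))"

lemma openin_atlas_topology:
  assumes "smooth_atlas A"
  shows "openin (atlas_topology A) W \<longleftrightarrow>
           W \<subseteq> points A \<and> (\<forall>c\<in>A. open (snd c ` (W \<inter> fst c)))"
proof -
  have inj: "inj_on (snd c) (fst c)" if "c \<in> A" for c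
    using assms that by (auto simp: smooth_atlas_def)
  have "istopology (\<lambda>W. W \<subseteq> points A \<and> (\<forall>c\<in>A. open (snd c ` (W \<inter> fst c))))"
    unfolding istopology_def
  proof (intro conjI allI impI ballI)
    fix S T c
    assume S: "S \<subseteq> points A \<and> (\<forall>c\<in>A. open (snd c ` (S \<inter> fst c)))"
      and T: "T \<subseteq> points A \<and> (\<forall>c\<in>A. open (snd c ` (T \<inter> fst c)))" and c: "c \<in> A"
    have "snd c ` (S \<inter> T \<inter> fst c) = snd c ` (S \<inter> fst c) \<inter> snd c ` (T \<inter> fst c)"
      using inj[OF c] by (auto simp: inj_on_def)
    then show "open (snd c ` (S \<inter> T \<inter> fst c))"
      using S T c by auto
  next
    fix K c
    assume K: "\<forall>W\<in>K. W \<subseteq> points A \<and> (\<forall>c\<in>A. open (snd c ` (W \<inter> fst c)))" and c: "c \<in> A"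
    have "snd c ` (\<Union> K \<inter> fst c) = (\<Union>W\<in>K. snd c ` (W \<inter> fst c))"
      by blast
    then show "open (snd c ` (\<Union> K \<inter> fst c))"
      using K c by auto
  qed blast+
  then show ?thesis
    by (simp add: atlas_topology_def topology_inverse')
qed

definition smooth_manifold :: "('m, 'e::euclidean_space) atlas \<Rightarrow> bool" where
  "smooth_manifold A \<longleftrightarrow>
     smooth_atlas A \<and> Hausdorff_space (atlas_topology A) \<and> second_countable (atlas_topology A)"

text \<open>The openness condition expresses continuity of the map.\<close>

definition smooth_map ::
  "('m, 'e::euclidean_space) atlas \<Rightarrow> ('n, 'd::euclidean_space) atlas \<Rightarrow> ('m \<Rightarrow> 'n) \<Rightarrow> bool" where
  "smooth_map A B F \<longleftrightarrow>
     F ` points A \<subseteq> points B \<and>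
     (\<forall>c\<in>A. \<forall>d\<in>B. open (snd c ` (fst c \<inter> F -` fst d)) \<and>
        smooth_on (snd c ` (fst c \<inter> F -` fst d)) (snd d \<circ> F \<circ> chart_inv c))"


section \<open>Tangent vectors\<close>

text \<open>
  At every point \<open>x\<close> one chart \<open>chart_at A x\<close> of the atlas is singled out.  A tangent vector at
  \<open>x\<close> is represented by its coordinates in that chart, so that the tangent space at each point is
  a copy of the model space \<open>'e\<close>, and a point of the tangent bundle is a pair \<open>(x, v)\<close> with
  \<open>x \<in> points A\<close> and \<open>v :: 'e\<close>.  Representations in other charts are obtained by the
  differentials of the transition maps; the norm of \<open>'e\<close> has no geometric meaning.
\<close>

definition chart_at :: "('m, 'e) atlas \<Rightarrow> 'm \<Rightarrow> ('m, 'e) chart" where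
  "chart_at A x = (SOME c. c \<in> A \<and> x \<in> fst c)"

definition coord_change ::
  "('m, 'e::euclidean_space) chart \<Rightarrow> ('m, 'e) chart \<Rightarrow> 'm \<Rightarrow> 'e \<Rightarrow> 'e" where
  "coord_change c d x = frechet_derivative (snd d \<circ> chart_inv c) (at (snd c x))"

definition tangent_atlas :: "('m, 'e::euclidean_space) atlas \<Rightarrow> ('m \<times> 'e, 'e \<times> 'e) atlas" where
  "tangent_atlas A =
     (\<lambda>c. (fst c \<times> UNIV, \<lambda>(x, v). (snd c x, coord_change (chart_at A x) c x v))) ` A"

definition differentiable_at :: "('m, 'e::euclidean_space) atlas \<Rightarrow> ('m \<Rightarrow> real) \<Rightarrow> 'm \<Rightarrow> bool" where
  "differentiable_at A f x \<longleftrightarrow>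
     (\<forall>c\<in>A. x \<in> fst c \<longrightarrow> (f \<circ> chart_inv c) differentiable (at (snd c x)))"

definition differential :: "('m, 'e::euclidean_space) atlas \<Rightarrow> ('m \<Rightarrow> real) \<Rightarrow> 'm \<Rightarrow> 'e \<Rightarrow> real" where
  "differential A f x =
     frechet_derivative (f \<circ> chart_inv (chart_at A x)) (at (snd (chart_at A x) x))"

definition loc_lipschitz :: "('m, 'e::euclidean_space) atlas \<Rightarrow> ('m \<Rightarrow> real) \<Rightarrow> bool" where
  "loc_lipschitz A f \<longleftrightarrow>
     (\<forall>c\<in>A. \<forall>a\<in>snd c ` fst c. \<exists>u>0. \<exists>C.
        C-lipschitz_on (ball a u \<inter> snd c ` fst c) (f \<circ> chart_inv c))"


section \<open>Riemannian metrics\<close>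

type_synonym ('m, 'e) metric = "'m \<Rightarrow> 'e \<Rightarrow> 'e \<Rightarrow> real"

text \<open>
  The last condition says that the coefficients of the metric are smooth in every chart.
\<close>

definition riemannian_metric :: "('m, 'e::euclidean_space) atlas \<Rightarrow> ('m, 'e) metric \<Rightarrow> bool" where
  "riemannian_metric A g \<longleftrightarrow>
     (\<forall>x\<in>points A. bilinear (g x) \<and> (\<forall>u v. g x u v = g x v u) \<and> (\<forall>v. v \<noteq> 0 \<longrightarrow> 0 < g x v v)) \<and>
     (\<forall>c\<in>A. \<forall>u v. smooth_on (snd c ` fst c)
        (\<lambda>a. let x = chart_inv c a
              in g x (coord_change c (chart_at A x) x u) (coord_change c (chart_at A x) x v)))"

definition riemannian_manifold :: "('m, 'e::euclidean_space) atlas \<Rightarrow> ('m, 'e) metric \<Rightarrow> bool" where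
  "riemannian_manifold A g \<longleftrightarrow> smooth_manifold A \<and> riemannian_metric A g"

definition tnorm :: "('m, 'e) metric \<Rightarrow> 'm \<Rightarrow> 'e \<Rightarrow> real" where
  "tnorm g x v = sqrt (g x v v)"

definition riem_grad ::
  "('m, 'e::euclidean_space) atlas \<Rightarrow> ('m, 'e) metric \<Rightarrow> ('m \<Rightarrow> real) \<Rightarrow> 'm \<Rightarrow> 'e" where
  "riem_grad A g f x = (THE w. \<forall>v. g x w v = differential A f x v)"


section \<open>Retractions\<close>

text \<open>
  Since \<open>R x 0 = x\<close>, the differential of \<open>R x\<close> at \<open>0\<close> takes values in the tangent space at \<open>x\<close>;
  it is computed in the chart in which tangent vectors at \<open>x\<close> are represented.
\<close>

definition manifold_retraction ::
  "('m, 'e::euclidean_space) atlas \<Rightarrow> ('m \<Rightarrow> 'e \<Rightarrow> 'm) \<Rightarrow> bool" where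
  "manifold_retraction A R \<longleftrightarrow>
     smooth_map (tangent_atlas A) A (\<lambda>(x, v). R x v) \<and>
     (\<forall>x\<in>points A. R x 0 = x \<and> ((snd (chart_at A x) \<circ> R x) has_derivative (\<lambda>v. v)) (at 0))"


section \<open>Clarke subdifferential and retraction-convexity\<close>

definition clarke_deriv :: "('e::real_normed_vector \<Rightarrow> real) \<Rightarrow> 'e \<Rightarrow> 'e \<Rightarrow> ereal" where
  "clarke_deriv h x v =
     Limsup (nhds x \<times>\<^sub>F at_right 0) (\<lambda>(y, t). ereal ((h (y + t *\<^sub>R v) - h y) / t))"

text \<open>The first argument is the inner product.\<close>

definition clarke_subdiff ::
  "('e::real_normed_vector \<Rightarrow> 'e \<Rightarrow> real) \<Rightarrow> ('e \<Rightarrow> real) \<Rightarrow> 'e \<Rightarrow> 'e set" where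
  "clarke_subdiff ip h x = {\<xi>. \<forall>v. ereal (ip \<xi> v) \<le> clarke_deriv h x v}"

definition riem_subdiff ::
  "('m, 'e::euclidean_space) metric \<Rightarrow> ('m \<Rightarrow> 'e \<Rightarrow> 'm) \<Rightarrow> ('m \<Rightarrow> real) \<Rightarrow> 'm \<Rightarrow> 'e set" where
  "riem_subdiff g R f x = clarke_subdiff (g x) (f \<circ> R x) 0"

definition retraction_convex ::
  "('m, 'e::euclidean_space) atlas \<Rightarrow> ('m, 'e) metric \<Rightarrow> ('m \<Rightarrow> 'e \<Rightarrow> 'm) \<Rightarrow> ('m \<Rightarrow> real) \<Rightarrow> bool" where
  "retraction_convex A g R f \<longleftrightarrow>
     (\<forall>x\<in>points A. \<forall>\<xi> \<eta>. \<forall>\<zeta>\<in>clarke_subdiff (g x) (f \<circ> R x) \<xi>.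
        f (R x \<eta>) \<ge> f (R x \<xi>) + g x \<zeta> (\<eta> - \<xi>))"


section \<open>Inexact oracles\<close>

text \<open>
  \<open>G x\<close> is the oracle vector at \<open>x\<close>.  For \<open>\<eta> = 0\<close> the inequality holds whatever the value of
  \<open>0 powr 0\<close> is, as \<open>R x 0 = x\<close> and \<open>\<delta> \<ge> 0\<close>.
\<close>

definition inexact_oracle ::
  "('m, 'e::euclidean_space) atlas \<Rightarrow> ('m, 'e) metric \<Rightarrow> ('m \<Rightarrow> 'e \<Rightarrow> 'm) \<Rightarrow> ('m \<Rightarrow> real) \<Rightarrow>
     real \<Rightarrow> real \<Rightarrow> real \<Rightarrow> ('m \<Rightarrow> 'e) \<Rightarrow> bool" where
  "inexact_oracle A g R f \<delta> L q G \<longleftrightarrow>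
     (\<forall>x\<in>points A. \<forall>\<eta>.
        f (R x \<eta>) \<le> f x + g x (G x) \<eta> + L / 2 * (tnorm g x \<eta>)\<^sup>2 + \<delta> * tnorm g x \<eta> powr q)"

end

theory Submission
  imports Defs
begin

text \<open>
  At a point \<open>x\<close> write \<open>h = f \<circ> R x\<close>.  Retraction-convexity turns a subgradient \<open>\<zeta>\<close> at \<open>x\<close> into the
  affine minorant \<open>f x + \<langle>\<zeta>, \<eta>\<rangle>\<close> of \<open>h\<close>, and the oracle is a majorant of \<open>h\<close> with slope \<open>G x\<close> through
  the same point.  Comparing the two along the ray spanned by \<open>\<zeta> - G x\<close> gives
  \<open>\<parallel>\<zeta> - G x\<parallel> \<le> L/2 * t + \<delta> * t powr (q - 1)\<close> for every radius \<open>t > 0\<close> (lemma \<open>radial_bound\<close>).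
  For \<open>q < 1\<close> the right-hand side is minimised in \<open>t\<close>; for \<open>q \<ge> 1\<close> one lets \<open>t\<close> tend to \<open>0\<close>.

  For \<open>q > 1\<close> this shows that \<open>G x\<close> is the only possible slope of an affine minorant touching \<open>h\<close>
  at \<open>0\<close>, but such a minorant must first be found.  It comes from the subgradients at other
  tangent vectors, about which the convexity hypothesis speaks as well.  Minimising \<open>h\<close> plus a
  large multiple of the squared distance to \<open>0\<close> yields Clarke subgradients at points arbitrarily
  close to \<open>0\<close>.  Each of them gives a global affine minorant of \<open>h\<close>, the slopes are bounded because
  \<open>h\<close> is bounded near \<open>0\<close>, and a limit of these minorants touches \<open>h\<close> at \<open>0\<close> (lemma
  \<open>affine_minorant\<close>).  Now \<open>h\<close> lies between two functions that agree to first order at \<open>0\<close>, so it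
  is differentiable there with gradient \<open>G x\<close>.

  It remains to pass from \<open>h\<close> to \<open>f\<close>.  In the chart that represents tangent vectors at \<open>x\<close>, the
  retraction is tangent to the identity, and \<open>f\<close> is locally Lipschitz.  So replacing the point
  \<open>R x v\<close> by the point with coordinates translated by \<open>v\<close> changes \<open>f\<close> by \<open>o(\<parallel>v\<parallel>)\<close> only, and \<open>f\<close> has in
  this chart the same derivative as \<open>h\<close> (lemma \<open>has_derivative_via_tangent_to_identity\<close>).
  Transition maps carry differentiability to all other charts.
\<close>

section \<open>Inner products on the model space\<close>

text \<open>
  The values of a Riemannian metric.  They are unrelated to the inner product of the type
  \<open>'e\<close>, whose norm serves only as a reference norm.
\<close>

locale inner_form =
  fixes b :: "'e::euclidean_space \<Rightarrow> 'e \<Rightarrow> real"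
  assumes bilinear: "bilinear b"
    and commute: "b u v = b v u"
    and pos: "v \<noteq> 0 \<Longrightarrow> 0 < b v v"
begin

lemma zero_left: "b 0 v = 0"
  using bilinear by (rule bilinear_lzero)

lemma linear_right: "linear (b u)"
  using bilinear by (simp add: bilinear_def)

lemma nonneg: "0 \<le> b v v"
  by (cases "v = 0") (simp_all add: zero_left pos less_imp_le)

lemma eq_if_same_functional:
  assumes "\<And>v. b u v = b w v"
  shows "u = w"
proof -
  have "b (u - w) (u - w) = 0"
    using assms bilinear_lsub[OF bilinear, of u w "u - w"] by simp
  then show ?thesis
    using pos[of "u - w"] by auto
qed

text \<open>
  Riesz representation, used to translate slopes with respect to the inner product of the type into
  slopes with respect to the metric.  By bilinearity \<open>b w\<close> is the functional \<open>v \<mapsto> T w \<bullet> v\<close> for a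
  linear operator \<open>T\<close>, which is injective by definiteness, hence surjective in finite dimension.
\<close>

lemma representer:
  assumes l: "linear l"
  obtains w where "\<And>v. b w v = l v"
proof -
  define T where "T w = (\<Sum>i\<in>Basis. b w i *\<^sub>R i)" for w
  have T: "T w \<bullet> v = b w v" for w v
  proof -
    have "b w v = b w (\<Sum>i\<in>Basis. (v \<bullet> i) *\<^sub>R i)"
      by (simp add: euclidean_representation)
    also have "\<dots> = (\<Sum>i\<in>Basis. (v \<bullet> i) * b w i)"
      by (simp add: linear_sum[OF linear_right] linear_scale[OF linear_right])
    also have "\<dots> = T w \<bullet> v"
      by (simp add: T_def inner_sum_left inner_sum_right inner_commute[of v] mult.commute)
    finally show ?thesis by simp
  qed
  have "linear T"
    unfolding T_def
    by (rule linearI)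
      (simp_all add: bilinear_ladd[OF bilinear] bilinear_lmul[OF bilinear] scaleR_left_distrib
        sum.distrib scaleR_sum_right)
  moreover have "inj T"
    by (rule injI) (metis T eq_if_same_functional)
  ultimately have "surj T"
    by (simp add: linear_injective_imp_surjective)
  then obtain w where w: "T w = (\<Sum>i\<in>Basis. l i *\<^sub>R i)"
    by (metis surjD)
  have "b w v = l v" for v
  proof -
    have "l v = l (\<Sum>i\<in>Basis. (v \<bullet> i) *\<^sub>R i)"
      by (simp add: euclidean_representation)
    also have "\<dots> = (\<Sum>i\<in>Basis. (v \<bullet> i) * l i)"
      by (simp add: linear_sum[OF l] linear_scale[OF l])
    also have "\<dots> = T w \<bullet> v"
      by (simp add: w inner_sum_left inner_sum_right inner_commute[of v] mult.commute)
    finally show ?thesis by (simp add: T)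
  qed
  then show ?thesis by (rule that)
qed

lemma norm_bound:
  obtains C where "C > 0" "\<And>v. sqrt (b v v) \<le> C * norm v"
proof -
  obtain B where B: "B > 0" "\<And>u v. norm (b u v) \<le> B * norm u * norm v"
    using bilinear_bounded_pos[OF bilinear] by blast
  have "sqrt (b v v) \<le> sqrt B * norm v" for v
  proof -
    have "b v v \<le> B * (norm v)\<^sup>2"
      using B(2)[of v v] nonneg[of v] by (simp add: power2_eq_square mult.assoc)
    then have "sqrt (b v v) \<le> sqrt (B * (norm v)\<^sup>2)"
      by simp
    then show ?thesis
      by (simp add: real_sqrt_mult)
  qed
  then show ?thesis
    using that[of "sqrt B"] B(1) by simp
qed

text \<open>
  The hypothesis at the multiple of \<open>w\<close> of length \<open>t\<close>, where Cauchy-Schwarz is an equality and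
  the left-hand side equals \<open>t\<close> times the length of \<open>w\<close>.
\<close>

lemma radial_bound:
  assumes "\<And>\<eta>. b w \<eta> \<le> L / 2 * (sqrt (b \<eta> \<eta>))\<^sup>2 + \<delta> * sqrt (b \<eta> \<eta>) powr q"
    and "0 \<le> L" "0 \<le> \<delta>" "0 < t"
  shows "sqrt (b w w) \<le> L / 2 * t + \<delta> * t powr (q - 1)"
proof (cases "w = 0")
  case True
  then show ?thesis
    using assms(2-4) by (simp add: zero_left)
next
  case False
  define N where "N = sqrt (b w w)"
  have N: "N > 0" "b w w = N * N"
    using pos[OF False] by (simp_all add: N_def)
  define \<eta> where "\<eta> = (t / N) *\<^sub>R w"
  have 1: "b w \<eta> = t * N" and "b \<eta> \<eta> = t * t"
    using N by (simp_all add: \<eta>_def bilinear_lmul[OF bilinear] bilinear_rmul[OF bilinear])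
  then have 2: "sqrt (b \<eta> \<eta>) = t"
    using assms(4) by simp
  have "t * N \<le> L / 2 * t\<^sup>2 + \<delta> * t powr q"
    using assms(1)[of \<eta>] unfolding 1 2 .
  also have "\<dots> = t * (L / 2 * t + \<delta> * t powr (q - 1))"
    using assms(4) by (simp add: powr_diff power2_eq_square field_simps)
  finally show ?thesis
    using assms(4) by (simp add: N_def)
qed

end

section \<open>Choosing the radius\<close>

text \<open>
  For positive \<open>\<delta>\<close> and \<open>L\<close> the bound is the minimum over \<open>t\<close>.  If one of them vanishes,
  the minimum need not be attained: the infimum \<open>0\<close> is approached for \<open>t\<close> tending to \<open>0\<close> or to infinity,
  and the claimed bound is \<open>0\<close> too because \<open>0 powr p = 0\<close>.
\<close>

lemma optimal_radius_bound:
  fixes N L \<delta> q :: real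
  assumes bound: "\<And>t. 0 < t \<Longrightarrow> N \<le> L / 2 * t + \<delta> * t powr (q - 1)"
    and "0 \<le> L" "0 \<le> \<delta>" "q < 1"
  shows "N \<le> (2 - q) * (L / (2 * (1 - q))) powr ((1 - q) / (2 - q)) * \<delta> powr (1 / (2 - q))"
proof -
  consider "\<delta> = 0" | "L = 0" | "0 < \<delta>" "0 < L"
    using assms(2,3) by fastforce
  then show ?thesis
  proof cases
    case 1
    have "((\<lambda>t. L / 2 * t) \<longlongrightarrow> L / 2 * 0) (at_right 0)"
      by (intro tendsto_intros)
    moreover have "\<forall>\<^sub>F t in at_right 0. N \<le> L / 2 * t"
      using bound 1 by (auto simp: eventually_at_right_less eventually_at_filter)
    ultimately have "N \<le> L / 2 * 0"
      by (rule tendsto_lowerbound) simp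
    then show ?thesis using 1 by simp
  next
    case 2
    have "((\<lambda>t. \<delta> * t powr (q - 1)) \<longlongrightarrow> \<delta> * 0) at_top"
      using assms(4) by (intro tendsto_intros tendsto_neg_powr filterlim_ident) auto
    moreover have "\<forall>\<^sub>F t in at_top. N \<le> \<delta> * t powr (q - 1)"
      using eventually_gt_at_top[of 0] by eventually_elim (use bound 2 in auto)
    ultimately have "N \<le> \<delta> * 0"
      by (rule tendsto_lowerbound) simp
    then show ?thesis using 2 by simp
  next
    case 3
    define c where "c = L / (2 * (1 - q))"
    have c: "c > 0" "L / 2 = c * (1 - q)"
      using 3 assms(4) by (simp_all add: c_def field_simps)
    define p where "p = 1 / (2 - q)"
    have p: "p * (q - 2) = -1" "p > 0"
      using assms(4) by (simp_all add: p_def field_simps)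
    \<comment> \<open>The zero of the derivative \<open>L / 2 - \<delta> * (1 - q) * t powr (q - 2)\<close> of the right-hand side.\<close>
    define t where "t = (\<delta> / c) powr p"
    have t: "t > 0" using c 3 by (simp add: t_def)
    have tq: "t powr (q - 2) = c / \<delta>"
      using c 3 p by (simp add: t_def powr_powr powr_minus)
    have "t powr (q - 1) = t * t powr (q - 2)"
      using t powr_add[of t 1 "q - 2"] by simp
    then have "\<delta> * t powr (q - 1) = c * t"
      using 3 tq by simp
    then have "N \<le> (2 - q) * (c * t)"
      using bound[OF t] by (simp add: c algebra_simps)
    also have "c * t = c powr (1 - p) * \<delta> powr p"
      using c 3 by (simp add: t_def powr_divide powr_diff)
    also have "1 - p = (1 - q) / (2 - q)"
      using assms(4) by (simp add: p_def field_simps)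
    finally show ?thesis
      by (simp add: c_def p_def mult.assoc)
  qed
qed

lemma limit_radius_bound:
  fixes N L \<delta> q :: real
  assumes bound: "\<And>t. 0 < t \<Longrightarrow> N \<le> L / 2 * t + \<delta> * t powr (q - 1)"
  shows "q = 1 \<Longrightarrow> N \<le> \<delta>" and "1 < q \<Longrightarrow> N \<le> 0"
proof -
  have ev: "\<forall>\<^sub>F t in at_right 0. N \<le> L / 2 * t + \<delta> * t powr (q - 1)"
    using bound by (auto simp: eventually_at_filter)
  show "N \<le> \<delta>" if "q = 1"
  proof -
    have "((\<lambda>t. L / 2 * t + \<delta>) \<longlongrightarrow> L / 2 * 0 + \<delta>) (at_right 0)"
      by (intro tendsto_intros)
    moreover have "\<forall>\<^sub>F t in at_right 0. N \<le> L / 2 * t + \<delta>"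
      using bound that by (auto simp: eventually_at_filter)
    ultimately have "N \<le> L / 2 * 0 + \<delta>"
      by (rule tendsto_lowerbound) simp
    then show ?thesis by simp
  qed
  show "N \<le> 0" if "1 < q"
  proof -
    have "((\<lambda>t::real. t powr (q - 1)) \<longlongrightarrow> 0 powr (q - 1)) (at_right 0)"
    proof (intro tendsto_powr2 tendsto_const tendsto_ident_at)
      show "\<forall>\<^sub>F t in at_right 0. (0::real) \<le> t"
        by (simp add: eventually_at_filter)
    qed (use that in simp)
    then have "((\<lambda>t. L / 2 * t + \<delta> * t powr (q - 1)) \<longlongrightarrow> L / 2 * 0 + \<delta> * 0 powr (q - 1)) (at_right 0)"
      by (intro tendsto_add tendsto_mult_left tendsto_ident_at)
    then have "N \<le> L / 2 * 0 + \<delta> * 0 powr (q - 1)"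
      using ev by (rule tendsto_lowerbound) simp
    then show ?thesis by simp
  qed
qed

section \<open>Clarke subgradients by penalisation\<close>

text \<open>
  The upper limit in the Clarke derivative also ranges over the moving base point; keeping the base
  point at \<open>y\<close> can only decrease it.
\<close>

lemma clarke_deriv_lower_bound:
  fixes h :: "'e::real_normed_vector \<Rightarrow> real"
  assumes lim: "(c \<longlongrightarrow> l) (at_right 0)"
    and le: "\<forall>\<^sub>F t in at_right 0. c t \<le> (h (y + t *\<^sub>R v) - h y) / t"
  shows "ereal l \<le> clarke_deriv h y v"
proof -
  let ?quot = "\<lambda>(y, t). ereal ((h (y + t *\<^sub>R v) - h y) / t)"
  have "filterlim (\<lambda>t. (y, t)) (nhds y \<times>\<^sub>F at_right 0) (at_right (0::real))"
    by (intro filterlim_Pair tendsto_const filterlim_ident)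
  then have sub: "filtermap (\<lambda>t. (y, t)) (at_right 0) \<le> nhds y \<times>\<^sub>F at_right (0::real)"
    by (simp add: filterlim_def)
  have "ereal l = Limsup (at_right 0) (\<lambda>t. ereal (c t))"
    using lim by (intro lim_imp_Limsup[symmetric]) simp_all
  also have "\<dots> \<le> Limsup (at_right 0) (\<lambda>t. ?quot (y, t))"
    by (rule Limsup_mono) (use le in simp)
  also have "\<dots> \<le> Limsup (filtermap (\<lambda>t. (y, t)) (at_right 0)) ?quot"
    by (rule Limsup_filtermap_ge)
  also have "\<dots> \<le> clarke_deriv h y v"
    unfolding clarke_deriv_def Limsup_def
    by (rule INF_superset_mono) (use sub in \<open>auto simp: le_filter_def\<close>)
  finally show ?thesis .
qed

text \<open>
  At a minimiser \<open>y\<close> of \<open>h + M * \<parallel>\<cdot> - a\<parallel>\<^sup>2\<close> over the ball, \<open>h\<close> is bounded below by a smooth function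
  that touches it at \<open>y\<close>, provided that \<open>y\<close> is interior; the gradient of that function is then a
  Clarke subgradient.  A large \<open>M\<close> keeps the minimiser off the boundary.
\<close>

lemma clarke_subgradient_nearby:
  fixes h :: "'e::euclidean_space \<Rightarrow> real"
  assumes cont: "continuous_on (cball a r) h" and "0 < r"
  obtains y \<xi> where "dist a y < r" "\<And>v. ereal (\<xi> \<bullet> v) \<le> clarke_deriv h y v"
proof -
  have "compact (h ` cball a r)"
    using cont by (intro compact_continuous_image) auto
  then obtain B where B: "\<And>z. z \<in> cball a r \<Longrightarrow> \<bar>h z\<bar> \<le> B"
    using compact_imp_bounded bounded_iff by (metis imageI real_norm_def)
  have "0 \<le> B"
    using B[of a] \<open>0 < r\<close> by fastforce
  \<comment> \<open>On the boundary sphere the penalty exceeds the oscillation \<open>2 * B\<close> of \<open>h\<close>.\<close>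
  define M where "M = (2 * B + 1) / r\<^sup>2"
  have M: "0 < M" "M * r\<^sup>2 = 2 * B + 1"
    using \<open>0 \<le> B\<close> \<open>0 < r\<close> by (simp_all add: M_def)
  have "continuous_on (cball a r) (\<lambda>z. h z + M * (norm (z - a))\<^sup>2)"
    by (intro continuous_intros cont)
  then obtain y where y: "y \<in> cball a r"
    and min: "\<And>z. z \<in> cball a r \<Longrightarrow> h y + M * (norm (y - a))\<^sup>2 \<le> h z + M * (norm (z - a))\<^sup>2"
    using continuous_attains_inf[of "cball a r" "\<lambda>z. h z + M * (norm (z - a))\<^sup>2"] \<open>0 < r\<close>
    by auto
  have "M * (norm (y - a))\<^sup>2 < M * r\<^sup>2"
    using min[of a] B[of a] B[OF y] \<open>0 < r\<close> M(2) by simp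
  then have "(norm (y - a))\<^sup>2 < r\<^sup>2"
    using M(1) by simp
  then have int: "dist a y < r"
    using \<open>0 < r\<close> by (simp add: dist_norm norm_minus_commute power_less_imp_less_base)
  define \<xi> where "\<xi> = - (2 * M) *\<^sub>R (y - a)"
  have "ereal (\<xi> \<bullet> v) \<le> clarke_deriv h y v" for v
  proof (rule clarke_deriv_lower_bound)
    have "((\<lambda>t. \<xi> \<bullet> v - M * t * (v \<bullet> v)) \<longlongrightarrow> \<xi> \<bullet> v - M * 0 * (v \<bullet> v)) (at_right 0)"
      by (intro tendsto_intros)
    then show "((\<lambda>t. \<xi> \<bullet> v - M * t * (v \<bullet> v)) \<longlongrightarrow> \<xi> \<bullet> v) (at_right 0)"
      by simp
    have "((\<lambda>t. dist a (y + t *\<^sub>R v)) \<longlongrightarrow> dist a (y + 0 *\<^sub>R v)) (at_right 0)"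
      by (intro tendsto_intros)
    then have "\<forall>\<^sub>F t in at_right 0. dist a (y + t *\<^sub>R v) < r"
      using int by (intro order_tendstoD(2)) auto
    moreover have "\<forall>\<^sub>F t in at_right 0. (0::real) < t"
      by (simp add: eventually_at_right_less)
    ultimately show "\<forall>\<^sub>F t in at_right 0. \<xi> \<bullet> v - M * t * (v \<bullet> v) \<le> (h (y + t *\<^sub>R v) - h y) / t"
    proof eventually_elim
      case (elim t)
      have "(norm (y + t *\<^sub>R v - a))\<^sup>2 = (norm (y - a))\<^sup>2 + t * (2 * ((y - a) \<bullet> v) + t * (v \<bullet> v))"
        by (simp add: power2_norm_eq_inner inner_simps inner_commute algebra_simps)
      then have "h y \<le> h (y + t *\<^sub>R v) + M * (t * (2 * ((y - a) \<bullet> v) + t * (v \<bullet> v)))"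
        using min[of "y + t *\<^sub>R v"] elim(1) by (simp add: distrib_left)
      then have "t * (\<xi> \<bullet> v - M * t * (v \<bullet> v)) \<le> h (y + t *\<^sub>R v) - h y"
        by (simp add: \<xi>_def algebra_simps)
      then show ?case
        using elim(2) by (simp add: pos_le_divide_eq mult.commute)
    qed
  qed
  then show ?thesis
    by (rule that[OF int])
qed

text \<open>
  The minorants that belong to subgradients at points \<open>y n\<close> tending to \<open>a\<close> have a limit that
  touches \<open>h\<close> at \<open>a\<close>, by compactness, once their slopes are bounded.
\<close>

lemma affine_minorant:
  fixes h :: "'e::euclidean_space \<Rightarrow> real"
  assumes cont: "continuous_on (cball a r) h" and "0 < r"
    and minorant: "\<And>y \<xi> \<eta>. (\<And>v. ereal (\<xi> \<bullet> v) \<le> clarke_deriv h y v) \<Longrightarrow> h y + \<xi> \<bullet> (\<eta> - y) \<le> h \<eta>"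
  obtains \<xi> where "\<And>\<eta>. h a + \<xi> \<bullet> (\<eta> - a) \<le> h \<eta>"
proof -
  have "\<exists>y \<xi>. dist a y < min (r / 2) (1 / Suc n) \<and> (\<forall>\<eta>. h y + \<xi> \<bullet> (\<eta> - y) \<le> h \<eta>)" for n
  proof -
    let ?s = "min (r / 2) (1 / Suc n)"
    have "continuous_on (cball a ?s) h" "0 < ?s"
      using \<open>0 < r\<close> by (auto intro: continuous_on_subset[OF cont])
    then show ?thesis
      by (rule clarke_subgradient_nearby) (use minorant in blast)
  qed
  then obtain y \<xi> where y: "\<And>n. dist a (y n) < min (r / 2) (1 / Suc n)"
    and low: "\<And>n \<eta>. h (y n) + \<xi> n \<bullet> (\<eta> - y n) \<le> h \<eta>"
    by metis
  have "compact (h ` cball a r)"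
    using cont by (intro compact_continuous_image) auto
  then obtain B where B: "\<And>z. z \<in> cball a r \<Longrightarrow> \<bar>h z\<bar> \<le> B"
    using compact_imp_bounded bounded_iff by (metis imageI real_norm_def)
  \<comment> \<open>A step of length \<open>r / 2\<close> in the direction \<open>\<xi> n\<close> stays in the ball and raises the minorant by
      \<open>r / 2 * norm (\<xi> n)\<close>, while \<open>h\<close> varies by at most \<open>2 * B\<close>.\<close>
  have "norm (\<xi> n) \<le> 4 * B / r" for n
  proof -
    let ?\<eta> = "y n + (r / 2) *\<^sub>R sgn (\<xi> n)"
    have "dist (y n) ?\<eta> \<le> r / 2"
      using \<open>0 < r\<close> by (simp add: dist_norm norm_sgn)
    then have "dist a ?\<eta> \<le> r"
      using y[of n] dist_triangle[of a ?\<eta> "y n"] by simp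
    then have "h ?\<eta> \<le> B" "- B \<le> h (y n)"
      using B[of ?\<eta>] B[of "y n"] y[of n] \<open>0 < r\<close> by auto
    moreover have "\<xi> n \<bullet> sgn (\<xi> n) = norm (\<xi> n)"
      by (cases "\<xi> n = 0") (simp_all add: sgn_div_norm flip: power2_norm_eq_inner, simp add: power2_eq_square)
    ultimately have "r / 2 * norm (\<xi> n) \<le> 2 * B"
      using low[of n ?\<eta>] by simp
    then show ?thesis
      using \<open>0 < r\<close> by (simp add: field_simps)
  qed
  then have "\<forall>n. \<xi> n \<in> cball 0 (4 * B / r)"
    by simp
  then obtain \<xi>0 \<sigma> where \<sigma>: "strict_mono \<sigma>" and lim\<xi>: "(\<xi> \<circ> \<sigma>) \<longlonglongrightarrow> \<xi>0"
    using compact_cball[of "0::'e" "4 * B / r"] unfolding compact_def by metis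
  have "y \<longlonglongrightarrow> a"
  proof (rule metric_tendsto_imp_tendsto[OF LIMSEQ_inverse_real_of_nat])
    show "\<forall>\<^sub>F n in sequentially. dist (y n) a \<le> dist (inverse (real (Suc n))) 0"
      using y by (auto simp: dist_commute inverse_eq_divide intro!: always_eventually less_imp_le)
  qed
  then have limy: "(y \<circ> \<sigma>) \<longlonglongrightarrow> a"
    using \<sigma> by (rule LIMSEQ_subseq_LIMSEQ)
  have "(\<lambda>n. h ((y \<circ> \<sigma>) n)) \<longlonglongrightarrow> h a"
  proof (rule continuous_on_tendsto_compose[OF cont limy])
    show "\<forall>\<^sub>F n in sequentially. (y \<circ> \<sigma>) n \<in> cball a r"
      using y \<open>0 < r\<close> by (intro always_eventually allI) (smt (verit) comp_apply field_sum_of_halves mem_cball)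
  qed (use \<open>0 < r\<close> in auto)
  then have "(\<lambda>n. h ((y \<circ> \<sigma>) n) + (\<xi> \<circ> \<sigma>) n \<bullet> (\<eta> - (y \<circ> \<sigma>) n)) \<longlonglongrightarrow> h a + \<xi>0 \<bullet> (\<eta> - a)" for \<eta>
    by (intro tendsto_intros lim\<xi> limy)
  then have "h a + \<xi>0 \<bullet> (\<eta> - a) \<le> h \<eta>" for \<eta>
    by (rule LIMSEQ_le_const2) (use low in auto)
  then show ?thesis by (rule that)
qed

section \<open>Differentiability\<close>

text \<open>
  The gap between the two bounds is \<open>o(\<parallel>\<eta>\<parallel>)\<close> exactly because \<open>q > 1\<close>.
\<close>

lemma (in inner_form) has_derivative_squeezed:
  assumes lower: "\<And>\<eta>. h 0 + b w \<eta> \<le> h \<eta>"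
    and upper: "\<And>\<eta>. h \<eta> \<le> h 0 + b w \<eta> + L / 2 * (sqrt (b \<eta> \<eta>))\<^sup>2 + \<delta> * sqrt (b \<eta> \<eta>) powr q"
    and "0 \<le> L" "0 \<le> \<delta>" "1 < q"
  shows "(h has_derivative b w) (at 0)"
proof -
  obtain C where C: "0 < C" "\<And>v. sqrt (b v v) \<le> C * norm v"
    using norm_bound by blast
  let ?H = "\<lambda>\<eta>::'e. L / 2 * C\<^sup>2 * norm \<eta> + \<delta> * C powr q * norm \<eta> powr (q - 1)"
  show ?thesis
  proof (rule has_derivativeI_sandwich[of 1])
    show "bounded_linear (b w)"
      by (simp add: linear_linear linear_right)
    have "((\<lambda>\<eta>::'e. norm \<eta> powr (q - 1)) \<longlongrightarrow> 0) (at 0)"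
      using \<open>1 < q\<close> by (intro tendsto_zero_powrI tendsto_const tendsto_norm_zero tendsto_ident_at) auto
    moreover have "((\<lambda>\<eta>::'e. norm \<eta>) \<longlongrightarrow> 0) (at 0)"
      by (intro tendsto_norm_zero tendsto_ident_at)
    ultimately have "(?H \<longlongrightarrow> L / 2 * C\<^sup>2 * 0 + \<delta> * C powr q * 0) (at 0)"
      by (intro tendsto_add tendsto_mult_left)
    then show "(?H \<longlongrightarrow> 0) (at 0)" by simp
  next
    fix \<eta> :: 'e assume "\<eta> \<noteq> 0"
    then have pos\<eta>: "0 < norm \<eta>" by simp
    have sq: "(sqrt (b \<eta> \<eta>))\<^sup>2 \<le> (C * norm \<eta>)\<^sup>2"
      using C(2) nonneg by (intro power_mono) auto
    have pw: "sqrt (b \<eta> \<eta>) powr q \<le> (C * norm \<eta>) powr q"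
      using C(2) nonneg \<open>1 < q\<close> by (intro powr_mono2) auto
    have "norm (h \<eta> - h 0 - b w \<eta>) \<le> L / 2 * (C * norm \<eta>)\<^sup>2 + \<delta> * (C * norm \<eta>) powr q"
      using lower[of \<eta>] upper[of \<eta>] mult_left_mono[OF sq, of "L / 2"] mult_left_mono[OF pw, of \<delta>]
        \<open>0 \<le> L\<close> \<open>0 \<le> \<delta>\<close> by simp
    also have "\<dots> = ?H \<eta> * norm \<eta>"
      using C(1) pos\<eta> by (simp add: powr_mult powr_diff power2_eq_square field_simps)
    finally show "norm (h \<eta> - h 0 - b w (\<eta> - 0)) / norm (\<eta> - 0) \<le> ?H \<eta>"
      using pos\<eta> by (simp add: pos_divide_le_eq)
  qed simp
qed

text \<open>
  \<open>F v\<close> differs from \<open>F 0 + v\<close> by \<open>o(\<parallel>v\<parallel>)\<close>, so for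
  Lipschitz \<open>k\<close> the functions \<open>v \<mapsto> k (F v)\<close> and \<open>v \<mapsto> k (F 0 + v)\<close> have the same derivative at \<open>0\<close>.
\<close>

lemma has_derivative_via_tangent_to_identity:
  fixes k :: "'e::real_normed_vector \<Rightarrow> real"
  assumes lip: "C-lipschitz_on U k" and U: "open U" "F 0 \<in> U"
    and F: "(F has_derivative (\<lambda>v. v)) (at 0)"
    and kF: "((k \<circ> F) has_derivative D) (at 0)"
  shows "(k has_derivative D) (at (F 0))"
proof -
  let ?d = "\<lambda>v. k (F 0 + v) - k (F v)"
  have "(?d has_derivative (\<lambda>v. 0)) (at 0)"
    unfolding has_derivative_iff_norm
  proof (intro conjI bounded_linear_zero)
    have "((\<lambda>v. norm (F v - F 0 - v) / norm v) \<longlongrightarrow> 0) (at 0)"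
      using F by (simp add: has_derivative_iff_norm)
    then have lim: "((\<lambda>v. C * (norm (F v - F 0 - v) / norm v)) \<longlongrightarrow> 0) (at 0)"
      by (rule tendsto_mult_right_zero)
    have "(F \<longlongrightarrow> F 0) (at 0)"
      using has_derivative_continuous[OF F] by (simp add: isCont_def)
    then have "\<forall>\<^sub>F v in at 0. F v \<in> U"
      using U by (rule topological_tendstoD)
    moreover have "((\<lambda>v. F 0 + v) \<longlongrightarrow> F 0 + 0) (at 0)"
      by (intro tendsto_intros)
    then have "\<forall>\<^sub>F v in at 0. F 0 + v \<in> U"
      using U by (intro topological_tendstoD) auto
    ultimately have "\<forall>\<^sub>F v in at 0.
        norm (norm (?d v - ?d 0 - 0) / norm (v - 0)) \<le> C * (norm (F v - F 0 - v) / norm v)"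
    proof eventually_elim
      case (elim v)
      have "\<bar>k (F 0 + v) - k (F v)\<bar> \<le> C * dist (F 0 + v) (F v)"
        using lipschitz_onD[OF lip elim(2,1)] by (simp add: dist_real_def)
      also have "dist (F 0 + v) (F v) = norm (F v - F 0 - v)"
        by (simp add: dist_norm norm_minus_commute diff_diff_eq)
      finally show ?case
        by (simp add: divide_right_mono)
    qed
    then show "((\<lambda>v. norm (?d v - ?d 0 - 0) / norm (v - 0)) \<longlongrightarrow> 0) (at 0)"
      using lim by (rule Lim_null_comparison)
  qed
  from has_derivative_add[OF this kF] have "((\<lambda>v. k (F 0 + v)) has_derivative D) (at 0)"
    by simp
  then have "((\<lambda>v. k (F 0 + v)) has_derivative D) (at (F 0 - F 0))"
    by simp
  moreover have "((\<lambda>a. a - F 0) has_derivative (\<lambda>v. v)) (at (F 0))"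
    by (auto intro!: derivative_eq_intros)
  ultimately have "((\<lambda>a. k (F 0 + (a - F 0))) has_derivative (\<lambda>v. D v)) (at (F 0))"
    by (rule has_derivative_compose[rotated])
  then show ?thesis by simp
qed


section \<open>Retractions and functions in charts\<close>

lemma chart_at:
  assumes "x \<in> points A"
  shows "chart_at A x \<in> A" "x \<in> fst (chart_at A x)"
proof -
  have "\<exists>c. c \<in> A \<and> x \<in> fst c"
    using assms by (auto simp: points_def)
  then have "chart_at A x \<in> A \<and> x \<in> fst (chart_at A x)"
    unfolding chart_at_def by (rule someI_ex)
  then show "chart_at A x \<in> A" "x \<in> fst (chart_at A x)" by auto
qed

context
  fixes A :: "('m, 'e::euclidean_space) atlas"
  assumes atlas: "smooth_atlas A"
begin

lemma chart_inv_eq: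
  assumes "c \<in> A" "x \<in> fst c"
  shows "chart_inv c (snd c x) = x"
  using atlas assms by (auto simp: smooth_atlas_def)

lemma open_chart_image:
  assumes "c \<in> A"
  shows "open (snd c ` fst c)"
  using atlas assms by (auto simp: smooth_atlas_def)

lemma coord_change_same_chart:
  assumes "c \<in> A" "x \<in> fst c"
  shows "coord_change c c x v = v"
proof -
  have "((snd c \<circ> chart_inv c) has_derivative (\<lambda>v. v)) (at (snd c x))"
  proof (rule has_derivative_transform_within_open)
    show "((\<lambda>v. v) has_derivative (\<lambda>v. v)) (at (snd c x))"
      by simp
    show "open (snd c ` fst c)"
      by (rule open_chart_image[OF assms(1)])
  qed (use assms chart_inv_eq in auto)
  then show ?thesis
    by (simp add: coord_change_def flip: frechet_derivative_at)
qed

text \<open>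
  Smoothness of a retraction is a property of the map on the tangent bundle, in bundle charts.  The
  chart \<open>T\<close> that covers \<open>chart_at A x\<close> sends a vector \<open>v\<close> at the point \<open>x\<close> itself to
  \<open>(snd d x, v)\<close> without changing coordinates; so the fibre over \<open>x\<close> is the slice with fixed
  first component, and openness of the domain and continuity restrict to this slice.
\<close>

lemma retraction_continuous_near_zero:
  assumes R: "manifold_retraction A R" and x: "x \<in> points A"
  obtains r where "r > 0" "R x ` cball 0 r \<subseteq> fst (chart_at A x)"
    "continuous_on (cball 0 r) (snd (chart_at A x) \<circ> R x)"
proof -
  define d where "d = chart_at A x"
  have d: "d \<in> A" "x \<in> fst d"
    using chart_at[OF x] by (simp_all add: d_def)
  define T :: "('m \<times> 'e, 'e \<times> 'e) chart" where
    "T = (fst d \<times> UNIV, \<lambda>(y, v). (snd d y, coord_change (chart_at A y) d y v))"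
  have "T \<in> tangent_atlas A"
    using d(1) by (simp add: T_def tangent_atlas_def)
  define W where "W = snd T ` (fst T \<inter> (\<lambda>(y, v). R y v) -` fst d)"
  define K where "K = snd d \<circ> (\<lambda>(y, v). R y v) \<circ> chart_inv T"
  have "open W" and sm: "smooth_on W K"
    using R \<open>T \<in> tangent_atlas A\<close> d(1)
    by (simp_all add: manifold_retraction_def smooth_map_def W_def K_def)
  from sm have contK: "continuous_on W K"
    unfolding smooth_on_def by (metis Ck_on.simps(1))
  have R0: "R x 0 = x"
    using R x by (simp add: manifold_retraction_def)
  have inj: "inj_on (snd d) (fst d)"
    using atlas d(1) by (auto simp: smooth_atlas_def)
  have snd_T: "snd T (x, v) = (snd d x, v)" for v
    using d by (simp add: T_def coord_change_same_chart flip: d_def)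
  \<comment> \<open>Injectivity of \<open>snd d\<close> forces the base point to be \<open>x\<close>, where the coordinate change is trivial.\<close>
  have over_x: "y = x \<and> u = v" if "y \<in> fst d" "snd T (y, u) = (snd d x, v)" for y u v
  proof -
    have "y = x"
      using that d(2) inj by (auto simp: T_def inj_on_def)
    then show ?thesis
      using that(2) snd_T by auto
  qed
  have inv_T: "chart_inv T (snd d x, v) = (x, v)" for v
  proof -
    have "(snd d x, v) \<in> snd T ` fst T"
      using snd_T[of v] d(2) by (intro image_eqI[of _ _ "(x, v)"]) (auto simp: T_def)
    then have "chart_inv T (snd d x, v) \<in> fst T" "snd T (chart_inv T (snd d x, v)) = (snd d x, v)"
      by (rule inv_into_into, rule f_inv_into_f)
    then show ?thesis
      using over_x[of "fst (chart_inv T (snd d x, v))" "snd (chart_inv T (snd d x, v))" v]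
      by (auto simp: T_def prod_eq_iff)
  qed
  have in_chart: "R x v \<in> fst d" if "(snd d x, v) \<in> W" for v
  proof -
    obtain y u where "y \<in> fst d" "R y u \<in> fst d" "snd T (y, u) = (snd d x, v)"
      using \<open>(snd d x, v) \<in> W\<close> unfolding W_def by (auto simp: T_def)
    then show ?thesis
      using over_x by blast
  qed
  have "(snd d x, 0) \<in> W"
    unfolding W_def using snd_T[of 0] d(2) R0 by (force simp: T_def)
  then have "0 \<in> Pair (snd d x) -` W" "open (Pair (snd d x) -` W)"
    using \<open>open W\<close> by (auto intro!: open_vimage continuous_intros)
  then obtain r where r: "r > 0" "cball 0 r \<subseteq> Pair (snd d x) -` W"
    using open_contains_cball by metis
  have "continuous_on (cball 0 r) (\<lambda>v. K (snd d x, v))"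
    by (rule continuous_on_compose2[OF contK]) (use r(2) in \<open>auto intro!: continuous_intros\<close>)
  then have "continuous_on (cball 0 r) (snd d \<circ> R x)"
    by (simp add: K_def inv_T o_def)
  moreover have "R x ` cball 0 r \<subseteq> fst d"
    using r(2) in_chart by blast
  ultimately show ?thesis
    using that[OF r(1)] by (simp add: d_def)
qed

lemma pullback_continuous_near_zero:
  assumes R: "manifold_retraction A R" and x: "x \<in> points A" and f: "loc_lipschitz A f"
  obtains r where "r > 0" "continuous_on (cball 0 r) (f \<circ> R x)"
    "\<And>v. norm v \<le> r \<Longrightarrow> R x v \<in> fst (chart_at A x)"
proof -
  define d where "d = chart_at A x"
  have d: "d \<in> A" "x \<in> fst d"
    using chart_at[OF x] by (simp_all add: d_def)
  obtain r where r: "r > 0" "R x ` cball 0 r \<subseteq> fst d" "continuous_on (cball 0 r) (snd d \<circ> R x)"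
    using retraction_continuous_near_zero[OF R x] unfolding d_def by blast
  have cont: "continuous_on (snd d ` fst d) (f \<circ> chart_inv d)"
  proof (rule continuous_at_imp_continuous_on, rule ballI)
    fix a assume a: "a \<in> snd d ` fst d"
    then obtain u C where u: "u > 0" "C-lipschitz_on (ball a u \<inter> snd d ` fst d) (f \<circ> chart_inv d)"
      using f d(1) unfolding loc_lipschitz_def by blast
    have "open (ball a u \<inter> snd d ` fst d)" "a \<in> ball a u \<inter> snd d ` fst d"
      using open_chart_image[OF d(1)] u(1) a by auto
    then show "isCont (f \<circ> chart_inv d) a"
      using lipschitz_on_continuous_on[OF u(2)] continuous_on_eq_continuous_at by blast
  qed
  have "continuous_on (cball 0 r) (\<lambda>v. (f \<circ> chart_inv d) ((snd d \<circ> R x) v))" (is ?chart)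
    by (rule continuous_on_compose2[OF cont r(3)]) (use r(2) in auto)
  also have "?chart \<longleftrightarrow> continuous_on (cball 0 r) (f \<circ> R x)"
  proof (rule continuous_on_cong[OF refl])
    fix v :: 'e assume "v \<in> cball 0 r"
    then have "R x v \<in> fst d"
      using r(2) by blast
    then show "(f \<circ> chart_inv d) ((snd d \<circ> R x) v) = (f \<circ> R x) v"
      using d(1) by (simp add: chart_inv_eq)
  qed
  finally show ?thesis
    using that[OF r(1)] r(2) by (force simp: d_def)
qed

lemma has_derivative_in_chart_at:
  assumes R: "manifold_retraction A R" and x: "x \<in> points A" and f: "loc_lipschitz A f"
    and D: "((f \<circ> R x) has_derivative D) (at 0)"
  shows "((f \<circ> chart_inv (chart_at A x)) has_derivative D) (at (snd (chart_at A x) x))"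
proof -
  define d where "d = chart_at A x"
  have d: "d \<in> A" "x \<in> fst d"
    using chart_at[OF x] by (simp_all add: d_def)
  obtain r where r: "r > 0" "\<And>v. norm v \<le> r \<Longrightarrow> R x v \<in> fst d"
    using pullback_continuous_near_zero[OF R x f] unfolding d_def by blast
  have R0: "R x 0 = x" and dR: "((snd d \<circ> R x) has_derivative (\<lambda>v. v)) (at 0)"
    using R x by (simp_all add: manifold_retraction_def d_def)
  have "snd d x \<in> snd d ` fst d"
    using d(2) by simp
  then obtain u C where
    u: "u > 0" "C-lipschitz_on (ball (snd d x) u \<inter> snd d ` fst d) (f \<circ> chart_inv d)"
    using f d(1) unfolding loc_lipschitz_def by meson
  have "((f \<circ> chart_inv d \<circ> (snd d \<circ> R x)) has_derivative D) (at 0)"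
  proof (rule has_derivative_transform_within_open[OF D, of "ball 0 r"])
    show "(f \<circ> R x) v = (f \<circ> chart_inv d \<circ> (snd d \<circ> R x)) v" if "v \<in> ball 0 r" for v
      using r(2)[of v] that d(1) by (simp add: chart_inv_eq)
  qed (use r(1) in auto)
  from has_derivative_via_tangent_to_identity[OF u(2) _ _ dR this]
  have "((f \<circ> chart_inv d) has_derivative D) (at ((snd d \<circ> R x) 0))"
    using open_chart_image[OF d(1)] u(1) d(2) by (auto simp: R0)
  then show ?thesis
    by (simp add: R0 d_def)
qed

lemma differentiable_at_if_in_one_chart:
  assumes d: "d \<in> A" "x \<in> fst d"
    and fd: "(f \<circ> chart_inv d) differentiable (at (snd d x))"
  shows "differentiable_at A f x"
  unfolding differentiable_at_def
proof (intro ballI impI)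
  fix c assume c: "c \<in> A" "x \<in> fst c"
  let ?V = "snd c ` (fst c \<inter> fst d)"
  have "open ?V" "smooth_on ?V (snd d \<circ> chart_inv c)"
    using atlas c(1) d(1) by (auto simp: smooth_atlas_def)
  moreover have "snd c x \<in> ?V"
    using c d by auto
  ultimately have "(snd d \<circ> chart_inv c) differentiable (at (snd c x))"
    unfolding smooth_on_def by (metis Ck_on.simps(2))
  moreover have "(f \<circ> chart_inv d) differentiable (at ((snd d \<circ> chart_inv c) (snd c x)))"
    using fd c by (simp add: chart_inv_eq)
  ultimately have "(f \<circ> chart_inv d \<circ> (snd d \<circ> chart_inv c)) differentiable (at (snd c x))"
    by (rule differentiable_chain_at)
  then obtain D where
    "((f \<circ> chart_inv d \<circ> (snd d \<circ> chart_inv c)) has_derivative D) (at (snd c x))"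
    by (auto simp: differentiable_def)
  then have "((f \<circ> chart_inv c) has_derivative D) (at (snd c x))"
  proof (rule has_derivative_transform_within_open[OF _ \<open>open ?V\<close> \<open>snd c x \<in> ?V\<close>])
    fix a assume "a \<in> ?V"
    then show "(f \<circ> chart_inv d \<circ> (snd d \<circ> chart_inv c)) a = (f \<circ> chart_inv c) a"
      using c(1) d(1) by (auto simp: chart_inv_eq)
  qed
  then show "(f \<circ> chart_inv c) differentiable (at (snd c x))"
    by (auto simp: differentiable_def)
qed

end

theorem proposition3p1:
  fixes A :: "('m, 'e::euclidean_space) atlas"
    and g :: "('m, 'e) metric"
    and R :: "'m \<Rightarrow> 'e \<Rightarrow> 'm"
    and f :: "'m \<Rightarrow> real"
    and G :: "'m \<Rightarrow> 'e"
    and \<delta> L q :: real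
  assumes "riemannian_manifold A g"
    and "manifold_retraction A R"
    and "loc_lipschitz A f"
    and "retraction_convex A g R f"
    and "0 \<le> \<delta>" and "0 \<le> L" and "0 \<le> q" and "q < 2"
    and "inexact_oracle A g R f \<delta> L q G"
  shows
    "(q < 1 \<longrightarrow> (\<forall>x\<in>points A. \<forall>\<zeta>\<in>riem_subdiff g R f x.
        tnorm g x (\<zeta> - G x)
          \<le> (2 - q) * (L / (2 * (1 - q))) powr ((1 - q) / (2 - q)) * \<delta> powr (1 / (2 - q)))) \<and>
     (q = 1 \<longrightarrow> (\<forall>x\<in>points A. \<forall>\<zeta>\<in>riem_subdiff g R f x. tnorm g x (\<zeta> - G x) \<le> \<delta>)) \<and>
     (1 < q \<longrightarrow> (\<forall>x\<in>points A. differentiable_at A f x \<and> G x = riem_grad A g f x))"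
proof -
  have atlas: "smooth_atlas A"
    using assms(1) by (simp add: riemannian_manifold_def smooth_manifold_def)
  have inner: "inner_form (g x)" if "x \<in> points A" for x
    using assms(1) that by (auto simp: riemannian_manifold_def riemannian_metric_def inner_form_def)
  have R0: "R x 0 = x" if "x \<in> points A" for x
    using assms(2) that by (simp add: manifold_retraction_def)
  have upper: "f (R x \<eta>) \<le> f x + g x (G x) \<eta> + L / 2 * (sqrt (g x \<eta> \<eta>))\<^sup>2 + \<delta> * sqrt (g x \<eta> \<eta>) powr q"
    if "x \<in> points A" for x \<eta>
    using assms(9) that by (simp add: inexact_oracle_def tnorm_def)
  \<comment> \<open>Stated for slopes of arbitrary minorants: for \<open>q > 1\<close> it is also applied to a minorant that does
      not come from a subgradient at \<open>0\<close>.\<close>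
  have gap: "tnorm g x (w - G x) \<le> L / 2 * t + \<delta> * t powr (q - 1)"
    if x: "x \<in> points A" and low: "\<And>\<eta>. f x + g x w \<eta> \<le> f (R x \<eta>)" and t: "0 < t" for x w t
  proof -
    interpret inner_form "g x" by (rule inner[OF x])
    have "g x (w - G x) \<eta> \<le> L / 2 * (sqrt (g x \<eta> \<eta>))\<^sup>2 + \<delta> * sqrt (g x \<eta> \<eta>) powr q" for \<eta>
      using low[of \<eta>] upper[OF x, of \<eta>] by (simp add: bilinear_lsub[OF bilinear])
    then show ?thesis
      unfolding tnorm_def using assms(5,6) t by (intro radial_bound) auto
  qed
  have low: "f x + g x \<zeta> \<eta> \<le> f (R x \<eta>)"
    if "x \<in> points A" "\<zeta> \<in> riem_subdiff g R f x" for x \<zeta> \<eta>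
    using assms(4) that R0 unfolding retraction_convex_def riem_subdiff_def by fastforce
  show ?thesis
  proof (intro conjI impI ballI)
    fix x \<zeta> assume "q < 1" and x: "x \<in> points A" "\<zeta> \<in> riem_subdiff g R f x"
    show "tnorm g x (\<zeta> - G x)
        \<le> (2 - q) * (L / (2 * (1 - q))) powr ((1 - q) / (2 - q)) * \<delta> powr (1 / (2 - q))"
      using gap[OF x(1) low[OF x]] assms(5,6) \<open>q < 1\<close> by (intro optimal_radius_bound) auto
  next
    fix x \<zeta> assume "q = 1" and x: "x \<in> points A" "\<zeta> \<in> riem_subdiff g R f x"
    show "tnorm g x (\<zeta> - G x) \<le> \<delta>"
      using gap[OF x(1) low[OF x]] \<open>q = 1\<close> by (rule limit_radius_bound(1))
  next
    fix x assume "1 < q" and x: "x \<in> points A"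
    interpret inner_form "g x" by (rule inner[OF x])
    define h where "h = f \<circ> R x"
    have h: "h \<eta> = f (R x \<eta>)" "h 0 = f x" for \<eta>
      by (simp_all add: h_def R0[OF x])
    obtain r where r: "r > 0" "continuous_on (cball 0 r) h"
      using pullback_continuous_near_zero[OF atlas assms(2) x assms(3)] unfolding h_def by blast
    have "h y + \<xi> \<bullet> (\<eta> - y) \<le> h \<eta>"
      if \<xi>: "\<And>v. ereal (\<xi> \<bullet> v) \<le> clarke_deriv h y v" for y \<xi> \<eta>
    proof -
      obtain \<zeta> where \<zeta>: "\<And>v. g x \<zeta> v = \<xi> \<bullet> v"
        using representer[of "\<lambda>v. \<xi> \<bullet> v"] bounded_linear.linear[OF bounded_linear_inner_right] by blast
      then have "\<zeta> \<in> clarke_subdiff (g x) (f \<circ> R x) y"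
        using \<xi> by (simp add: clarke_subdiff_def h_def)
      then show ?thesis
        using assms(4) x \<zeta> by (fastforce simp: retraction_convex_def h)
    qed
    with r obtain \<xi> where \<xi>: "\<And>\<eta>. h 0 + \<xi> \<bullet> (\<eta> - 0) \<le> h \<eta>"
      using affine_minorant[of 0 r h] by blast
    obtain w where "\<And>v. g x w v = \<xi> \<bullet> v"
      using representer[of "\<lambda>v. \<xi> \<bullet> v"] bounded_linear.linear[OF bounded_linear_inner_right] by blast
    with \<xi> have w: "f x + g x w \<eta> \<le> f (R x \<eta>)" for \<eta>
      using h by (metis diff_zero)
    have "tnorm g x (w - G x) \<le> 0"
      using gap[OF x w] \<open>1 < q\<close> by (rule limit_radius_bound(2))
    then have "w = G x"
      using pos[of "w - G x"] by (auto simp: tnorm_def)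
    then have "(h has_derivative g x (G x)) (at 0)"
      using w upper[OF x] assms(5,6) \<open>1 < q\<close>
      by (intro has_derivative_squeezed[where L = L and \<delta> = \<delta> and q = q]) (auto simp: h(1) R0[OF x])
    then have der: "((f \<circ> chart_inv (chart_at A x)) has_derivative g x (G x)) (at (snd (chart_at A x) x))"
      using has_derivative_in_chart_at[OF atlas assms(2) x assms(3)] unfolding h_def by blast
    then show "differentiable_at A f x"
      using differentiable_at_if_in_one_chart[OF atlas chart_at[OF x]] differentiableI by blast
    have "differential A f x = g x (G x)"
      unfolding differential_def using frechet_derivative_at[OF der] by simp
    then show "G x = riem_grad A g f x"
      unfolding riem_grad_def by (intro the_equality[symmetric]) (auto intro: eq_if_same_functional)
  qed
qed

end
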